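(* Let $\kappa\leq\lambda$ be infinite cardinals with $\kappa$ regular, and let $\lambda'=\lambda^{<\kappa}$. Then $(\lambda')^{<\kappa}=\lambda'$, and the space ${}^{\kappa}\lambda$ is homeomorphic to ${}^{\kappa}\lambda'$ (both with the bounded topology).
   Context: For a set $A$, ${}^{\kappa}A$ is the set of sequences of elements of $A$ of length $\kappa$, with the bounded topology, generated by the cones $\mathbf{N}_s=\{x\in{}^{\kappa}A\mid s\subseteq x\}$ for $s\in{}^{<\kappa}A=\bigcup_{\alpha<\kappa}{}^{\alpha}A$. $\lambda^{<\kappa}=\sup\{\lambda^{\theta}\mid\theta<\kappa\text{ a cardinal}\}$ (cardinal exponentiation). *)

theory Defs
  imports "HOL-Analysis.Analysis"
begin

unbundle cardinal_syntax
no_notation Set_Algebras.elt_set_eq (infix \<open>=o\<close> 50)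

text \<open>
  A cardinal is represented by a \<open>Card_order\<close>, that is, by a well-order \<open>k\<close> of minimal order type
  on its field; cardinals are compared by \<open>\<le>o\<close>, \<open><o\<close> and \<open>=o\<close>. The ordinals below \<open>k\<close> correspond to
  the elements \<open>a\<close> of \<open>Field k\<close>, the ordinal of \<open>a\<close> being the proper initial segment \<open>underS k a\<close>.
\<close>

definition is_card_Sup :: "'a rel set \<Rightarrow> 'a rel \<Rightarrow> bool" where
  "is_card_Sup R m \<longleftrightarrow>
     Card_order m \<and> (\<forall>r\<in>R. r \<le>o m) \<and>
     (\<forall>m' :: 'a rel. Card_order m' \<and> (\<forall>r\<in>R. r \<le>o m') \<longrightarrow> m \<le>o m')"

text \<open>
  The supremum is determined only up to \<open>=o\<close>, hence the choice operator. It always exists on the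
  type carrying the members of the family (\<open>is_card_Sup_card_Sup\<close>), and it is also the least among
  the upper bounds living on other types (\<open>card_Sup_least\<close>).
\<close>

definition card_Sup :: "'a rel set \<Rightarrow> 'a rel" where
  "card_Sup R = (SOME m. is_card_Sup R m)"

lemma is_card_Sup_card_Sup:
  fixes R :: "'a rel set"
  assumes "\<forall>r\<in>R. Card_order r"
  shows "is_card_Sup R (card_Sup R)"
proof -
  let ?U = "{m :: 'a rel. Card_order m \<and> (\<forall>r\<in>R. r \<le>o m)}"
  have "r \<le>o |UNIV :: 'a set|" if "r \<in> R" for r
  proof -
    have "r =o |Field r|"
      using assms that by (intro ordIso_symmetric[OF card_of_Field_ordIso]) simp
    moreover have "|Field r| \<le>o |UNIV :: 'a set|" by (rule card_of_mono1) simp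
    ultimately show ?thesis by (rule ordIso_ordLeq_trans)
  qed
  then have "|UNIV :: 'a set| \<in> ?U" by (simp add: card_of_Card_order)
  then have "?U \<noteq> {}" by blast
  moreover have "\<forall>m\<in>?U. Card_order m" by simp
  ultimately obtain m where m: "m \<in> ?U" "\<forall>m'\<in>?U. m \<le>o m'"
    using exists_minim_Card_order[of ?U] by meson
  then have "is_card_Sup R m" by (simp add: is_card_Sup_def)
  then show ?thesis unfolding card_Sup_def by (rule someI)
qed

lemma card_Sup_least:
  fixes R :: "'a rel set" and m' :: "'b rel"
  assumes R: "\<forall>r\<in>R. Card_order r" and m': "Card_order m'" and ub: "\<forall>r\<in>R. r \<le>o m'"
  shows "card_Sup R \<le>o m'"
proof (rule ccontr)
  let ?s = "card_Sup R"
  have s: "Card_order ?s" and least: "\<And>m :: 'a rel. Card_order m \<Longrightarrow> \<forall>r\<in>R. r \<le>o m \<Longrightarrow> ?s \<le>o m"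
    using is_card_Sup_card_Sup[OF R] by (auto simp: is_card_Sup_def)
  assume contr: "\<not> ?s \<le>o m'"
  moreover have "Well_order ?s" "Well_order m'"
    using s m' card_order_on_well_order_on by blast+
  ultimately have "m' \<le>o ?s"
    using ordLeq_total by blast
  then have "|Field m'| \<le>o |Field ?s|" by (rule card_of_mono2)
  then obtain f where f: "inj_on f (Field m')" "f ` Field m' \<subseteq> Field ?s"
    using card_of_ordLeq[of "Field m'" "Field ?s"] by blast
  have "|Field m'| =o |f ` Field m'|"
    using card_of_ordIsoI[OF inj_on_imp_bij_betw[OF f(1)]] .
  then have iso: "m' =o |f ` Field m'|"
    using ordIso_transitive[OF ordIso_symmetric[OF card_of_Field_ordIso[OF m']]] by simp
  have "\<forall>r\<in>R. r \<le>o |f ` Field m'|" by (intro ballI ordLeq_ordIso_trans[OF _ iso] ub[rule_format])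
  then have "?s \<le>o |f ` Field m'|" by (rule least[OF card_of_Card_order])
  from ordLeq_ordIso_trans[OF this ordIso_symmetric[OF iso]] contr show False by contradiction
qed

text \<open>
  Every cardinal below \<open>k\<close> has a representative on the type of \<open>k\<close>, so it suffices to let the
  exponent \<open>t\<close> range over relations on that type.
\<close>

definition cexp_less :: "'l rel \<Rightarrow> 'k rel \<Rightarrow> ('k \<Rightarrow> 'l) rel" where
  "cexp_less l k = card_Sup {l ^c t | t :: 'k rel. Card_order t \<and> t <o k}"

text \<open>
  \<open>Func D A\<close> is the set of functions from \<open>D\<close> to \<open>A\<close>, made total by the value \<open>undefined\<close> outside \<open>D\<close>.
  The cone of a sequence \<open>s\<close> thus needs the length of \<open>s\<close>, given by \<open>a\<close>, as an extra argument.
\<close>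

definition seq_cone :: "'k rel \<Rightarrow> 'a set \<Rightarrow> 'k \<Rightarrow> ('k \<Rightarrow> 'a) \<Rightarrow> ('k \<Rightarrow> 'a) set" where
  "seq_cone k A a s = {x \<in> Func (Field k) A. \<forall>b\<in>underS k a. x b = s b}"

definition bounded_topology :: "'k rel \<Rightarrow> 'a set \<Rightarrow> ('k \<Rightarrow> 'a) topology" where
  "bounded_topology k A =
     topology_generated_by {seq_cone k A a s | a s. a \<in> Field k \<and> s \<in> Func (underS k a) A}"

lemma topspace_bounded_topology:
  assumes "Field k \<noteq> {}"
  shows "topspace (bounded_topology k A) = Func (Field k) A"
proof -
  obtain a where a: "a \<in> Field k" using assms by blast
  have "x \<in> topspace (bounded_topology k A)" if x: "x \<in> Func (Field k) A" for x
  proof -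
    let ?s = "\<lambda>b. if b \<in> underS k a then x b else undefined"
    have "?s \<in> Func (underS k a) A"
      using x underS_Field[of _ k a] by (auto simp: Func_def)
    moreover have "x \<in> seq_cone k A a ?s" using x by (simp add: seq_cone_def)
    ultimately show ?thesis using a unfolding bounded_topology_def topology_generated_by_topspace by blast
  qed
  then show ?thesis
    by (auto simp: bounded_topology_def seq_cone_def)
qed

end

theory Submission
  imports Defs
begin

text \<open>
  Since \<open>k\<close> is regular, bijections each of whose output coordinates depends, locally and in both
  directions, on fewer than \<open>k\<close> input coordinates are homeomorphisms; so only the size of the index
  set matters, not its order. View a sequence of length \<open>k\<close> over \<open>l\<close> as \<open>k\<close> many rows of length
  \<open>k\<close>. The header of a row, an element of \<open>l\<close>, codes a length below \<open>k\<close>, and the part of the row of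
  that length is read, together with the header, as one letter of an alphabet \<open>C\<close> of size \<open>cexp_less l k\<close>. The
  remainders of all the rows form one more sequence of length \<open>k\<close> over \<open>l\<close>. So the space of
  \<open>k\<close>-sequences over \<open>l\<close> is homeomorphic to that over \<open>C \<times> l\<close>, and \<open>C \<times> l\<close> has size \<open>cexp_less l k\<close>.
\<close>

section \<open>Weak powers\<close>

lemma finite_imp_card_of_ordLess:
  assumes "Cinfinite k" "finite A"
  shows "|A| <o k"
  by (rule Cfinite_ordLess_Cinfinite[OF _ assms(1)])
    (simp add: assms(2) cfinite_def card_of_card_order_on Field_card_of)

lemma card_under_ordLess:
  assumes k: "Cinfinite k" and a: "a \<in> Field k"
  shows "|under k a| <o k"
proof -
  have "|{a}| <o k"
    using k by (rule finite_imp_card_of_ordLess) simp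
  moreover have "|underS k a| <o k"
    using k a by (simp add: card_of_underS)
  ultimately have "|{a} \<union> underS k a| <o k"
    using k card_of_Un_ordLess_infinite_Field unfolding cinfinite_def by blast
  moreover have "under k a \<subseteq> {a} \<union> underS k a"
    by (auto simp: under_def underS_def)
  ultimately show ?thesis
    using card_of_mono1 ordLeq_ordLess_trans by blast
qed

text \<open>A strictly smaller well-order is isomorphic to a proper initial segment, which the
  matching closed segment contains. This bounds every exponent entering \<open>cexp_less\<close> by
  a closed segment.\<close>

lemma ordLess_imp_ordLeq_under:
  assumes k: "Card_order k" and t: "Card_order t" and less: "t <o k"
  obtains a where "a \<in> Field k" "t \<le>o |under k a|"
proof -
  obtain a where a: "a \<in> Field k" "t =o Restr k (underS k a)"
    using less ordLess_iff_ordIso_Restr[of k t] card_order_on_well_order_on[OF k]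
      card_order_on_well_order_on[OF t] by blast
  have "|Field t| \<le>o |Field (Restr k (underS k a))|"
    using a(2) by (simp add: card_of_mono2 ordIso_imp_ordLeq)
  also have "|Field (Restr k (underS k a))| \<le>o |under k a|"
    by (rule card_of_mono1) (auto simp: Field_def under_def underS_def)
  finally have "t \<le>o |under k a|"
    using card_of_Field_ordIso[OF t] ordIso_ordLeq_trans ordIso_symmetric by blast
  with a(1) that show ?thesis by blast
qed

lemma Cnotzero_card_of_under:
  assumes "Card_order k" "a \<in> Field k"
  shows "Cnotzero |under k a|"
proof -
  have "Refl k"
    using assms(1) card_order_on_well_order_on well_order_on_def linear_order_on_def
      partial_order_on_def preorder_on_def by metis
  then have "a \<in> under k a"
    using assms(2) by (simp add: under_def refl_on_def)
  then show ?thesis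
    by (metis Field_card_of card_of_Card_order czeroE empty_iff)
qed

section \<open>The supremum of the small powers\<close>

lemma is_card_Sup_cexp_less:
  "is_card_Sup {l ^c t | t :: 'k rel. Card_order t \<and> t <o k} (cexp_less l (k :: 'k rel))"
  unfolding cexp_less_def by (rule is_card_Sup_card_Sup) (auto simp: Card_order_cexp)

text \<open>The exponent \<open>t\<close> may live on any type, while the supremum ranges over
  relations on the type of \<open>k\<close>. An isomorphic copy of \<open>t\<close> on that type
  gives the same power.\<close>

lemma cexp_ordLeq_cexp_less:
  fixes k :: "'k rel"
  assumes l: "Card_order l" and t: "Card_order t" and less: "t <o k"
  shows "l ^c t \<le>o cexp_less l k"
proof -
  obtain p :: "'k rel" where p: "t =o p" "p <o k"
    using internalize_ordLess[of t k] less by blast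
  have "Card_order p" using Card_order_ordIso2 p(1) t by blast
  then have "l ^c t =o l ^c p" "l ^c p \<le>o cexp_less l k"
    using cexp_cong2[OF p(1) l t] p is_card_Sup_cexp_less[of l k] unfolding is_card_Sup_def by blast+
  then show ?thesis by (rule ordIso_ordLeq_trans)
qed

lemma cexp_less_least:
  fixes k :: "'k rel"
  assumes "Card_order m" and "\<And>t :: 'k rel. Card_order t \<Longrightarrow> t <o k \<Longrightarrow> l ^c t \<le>o m"
  shows "cexp_less l k \<le>o m"
  unfolding cexp_less_def using assms by (intro card_Sup_least) (auto simp: Card_order_cexp)

lemma ordLeq_cexp_less:
  assumes k: "Cinfinite k" and l: "Card_order l"
  shows "l \<le>o cexp_less l k"
proof -
  obtain a where a: "a \<in> Field k"
    using k unfolding cinfinite_def by fastforce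
  have "l \<le>o l ^c |under k a|"
    by (rule ordLeq_cexp1[OF Cnotzero_card_of_under l]) (use a k in auto)
  also have "l ^c |under k a| \<le>o cexp_less l k"
    by (rule cexp_ordLeq_cexp_less[OF l card_of_Card_order card_under_ordLess[OF k a]])
  finally show ?thesis .
qed

lemma Cinfinite_cexp_less:
  assumes "Cinfinite k" "Cinfinite l"
  shows "Cinfinite (cexp_less l k)"
  using assms cinfinite_mono[OF ordLeq_cexp_less[OF assms(1), of l]] is_card_Sup_cexp_less[of l k]
  unfolding is_card_Sup_def by blast

text \<open>
  Closed segments \<open>under\<close> keep the domains nonempty, which makes exponentiation by
  them monotone.
\<close>

definition coded_seqs :: "'k rel \<Rightarrow> 'a set \<Rightarrow> ('a \<Rightarrow> 'k) \<Rightarrow> ('a \<times> ('k \<Rightarrow> 'a)) set" where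
  "coded_seqs k A f = (SIGMA a:A. Func (under k (f a)) A)"

text \<open>From above: there are \<open>l\<close> fibres, each of size at most
  \<open>cexp_less l k\<close>, which is infinite and at least \<open>l\<close>. From below: each
  exponent is bounded by a closed segment, and because \<open>f\<close> is onto, some header codes
  that segment, so one fibre is already large enough.\<close>

lemma card_coded_seqs:
  assumes k: "Cinfinite k" and l: "Cinfinite l" and f: "f ` Field l = Field k"
  shows "|coded_seqs k (Field l) f| =o cexp_less l k"
proof -
  have "|coded_seqs k (Field l) f| \<le>o cexp_less l k"
    unfolding coded_seqs_def
  proof (rule card_of_Sigma_ordLeq_infinite_Field)
    show "\<not> finite (Field (cexp_less l k))" "Card_order (cexp_less l k)"
      using Cinfinite_cexp_less[OF k l] by (auto simp: cinfinite_def)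
    show "|Field l| \<le>o cexp_less l k"
      using ordLeq_cexp_less[OF k] card_of_Field_ordIso l ordIso_ordLeq_trans by blast
    show "\<forall>a\<in>Field l. |Func (under k (f a)) (Field l)| \<le>o cexp_less l k"
    proof
      fix a assume "a \<in> Field l"
      then have "f a \<in> Field k" using f by blast
      then have "l ^c |under k (f a)| \<le>o cexp_less l k"
        using k l
        by (intro cexp_ordLeq_cexp_less card_of_Card_order card_under_ordLess) auto
      then show "|Func (under k (f a)) (Field l)| \<le>o cexp_less l k"
        by (simp add: cexp_def Field_card_of)
    qed
  qed
  moreover have "cexp_less l k \<le>o |coded_seqs k (Field l) f|"
  proof (rule cexp_less_least[OF card_of_Card_order])
    fix t :: "'a rel" assume t: "Card_order t" "t <o k"
    obtain b where b: "b \<in> Field k" "t \<le>o |under k b|"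
      using ordLess_imp_ordLeq_under t k by blast
    obtain a where a: "a \<in> Field l" "f a = b" using f b(1) by (metis imageE)
    show "l ^c t \<le>o |coded_seqs k (Field l) f|"
    \<comment> \<open>Monotonicity in the exponent is applied to nonzero exponents only. For
      exponent zero the power is 1, so one coded sequence suffices.\<close>
    proof (cases "t =o (czero :: 'a rel)")
      case True
      have "Func (under k (f a)) (Field l) \<noteq> {}"
        using a(1) Func_is_emp[of "under k (f a)" "Field l"] by auto
      then have "coded_seqs k (Field l) f \<noteq> {}"
        unfolding coded_seqs_def Sigma_empty_iff using a(1) by blast
      moreover have "Field t = {}" using True czeroE by blast
      ultimately show ?thesis
        by (simp add: cexp_def Func_empty card_of_singl_ordLeq)
    next
      case False
      have "l ^c t \<le>o l ^c |under k b|"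
        using cexp_mono2_Cnotzero b(2) l t(1) False by blast
      also have "l ^c |under k b| = |Func (under k (f a)) (Field l)|"
        by (simp add: cexp_def a Field_card_of)
      also have "|Func (under k (f a)) (Field l)| \<le>o |coded_seqs k (Field l) f|"
        unfolding card_of_ordLeq[symmetric]
        by (rule exI[of _ "Pair a"]) (auto simp: inj_on_def coded_seqs_def a)
      finally show ?thesis .
    qed
  qed
  ultimately show ?thesis by (simp add: ordIso_iff_ordLeq)
qed

text \<open>
  By regularity a family of fewer than \<open>k\<close> coded sequences has bounded lengths, so it amounts
  to a single sequence of length below \<open>k\<close>.
\<close>

lemma Func_coded_seqs_ordLeq:
  assumes k: "Cinfinite k" and reg: "regularCard k" and l: "Cinfinite l" and kl: "k \<le>o l"
    and f: "f ` Field l = Field k" and T: "|T| <o k"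
  shows "|Func T (coded_seqs k (Field l) f)| \<le>o cexp_less l k"
proof -
  \<comment> \<open>\<open>Q b\<close> collects the coded sequences whose length code is at most
    \<open>b\<close>. These sets increase with \<open>b\<close> and exhaust all coded sequences, so
    regularity puts the fewer than \<open>k\<close> values of \<open>u\<close> into a single
    one.\<close>
  define Q where "Q b = (SIGMA a:{a \<in> Field l. f a \<in> under k b}. Func (under k (f a)) (Field l))" for b
  have tr: "trans k"
    using k card_order_on_well_order_on well_order_on_def linear_order_on_def
      partial_order_on_def preorder_on_def by metis
  have "Func T (coded_seqs k (Field l) f) \<subseteq> (\<Union>b\<in>Field k. Func T (Q b))"
  proof
    fix u assume u: "u \<in> Func T (coded_seqs k (Field l) f)"
    have "\<exists>b\<in>Field k. u ` T \<subseteq> Q b"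
    proof (rule regularCard_UNION)
      show "Card_order k" "regularCard k" using k reg by auto
      show "relChain k Q"
        using tr by (fastforce simp: relChain_def Q_def under_def dest: transD)
      show "u ` T \<subseteq> \<Union> (Q ` Field k)"
      proof
        fix p assume "p \<in> u ` T"
        then have p: "p \<in> coded_seqs k (Field l) f" using u by (auto simp: Func_def)
        then have "f (fst p) \<in> Field k" using f by (auto simp: coded_seqs_def)
        moreover then have "f (fst p) \<in> under k (f (fst p))"
          using k card_order_on_well_order_on well_order_on_def linear_order_on_def
            partial_order_on_def preorder_on_def unfolding refl_on_def under_def by fastforce
        ultimately show "p \<in> \<Union> (Q ` Field k)"
          using p by (force simp: coded_seqs_def Q_def)
      qed
      show "|u ` T| <o k" using T card_of_image ordLeq_ordLess_trans by blast
    qed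
    then show "u \<in> (\<Union>b\<in>Field k. Func T (Q b))"
      using u by (fastforce simp: Func_def)
  qed
  then have "|Func T (coded_seqs k (Field l) f)| \<le>o |\<Union>b\<in>Field k. Func T (Q b)|"
    by (rule card_of_mono1)
  also have "|\<Union>b\<in>Field k. Func T (Q b)| \<le>o cexp_less l k"
  proof (rule card_of_UNION_ordLeq_infinite_Field)
    show "\<not> finite (Field (cexp_less l k))" "Card_order (cexp_less l k)"
      using Cinfinite_cexp_less[OF k l] by (auto simp: cinfinite_def)
    show "|Field k| \<le>o cexp_less l k"
      using ordLeq_cexp_less[OF k] card_of_Field_ordIso k l kl ordIso_ordLeq_trans
        ordLeq_transitive by blast
    show "\<forall>b\<in>Field k. |Func T (Q b)| \<le>o cexp_less l k"
    proof
      fix b assume b: "b \<in> Field k"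
      let ?s = "|under k b|"
      have nz: "Cnotzero ?s" using Cnotzero_card_of_under[of k b] b k by simp
      have l_le: "l \<le>o l ^c ?s" using ordLeq_cexp1 nz l by blast
      then have inf: "Cinfinite (l ^c ?s)" using cinfinite_mono l Card_order_cexp by blast
      \<comment> \<open>There are at most \<open>l\<close> headers, each with at most
        \<open>l ^c ?s\<close> sequences, and \<open>l\<close> is itself at most that power.\<close>
      have "|Q b| \<le>o l ^c ?s"
        unfolding Q_def
      proof (rule card_of_Sigma_ordLeq_infinite_Field)
        show "\<not> finite (Field (l ^c ?s))" "Card_order (l ^c ?s)"
          using inf by (auto simp: cinfinite_def)
        have "|{a \<in> Field l. f a \<in> under k b}| \<le>o |Field l|"
          by (rule card_of_mono1) auto
        then show "|{a \<in> Field l. f a \<in> under k b}| \<le>o l ^c ?s"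
          using l_le l card_of_Field_ordIso ordLeq_ordIso_trans ordLeq_transitive by blast
        show "\<forall>a\<in>{a \<in> Field l. f a \<in> under k b}. |Func (under k (f a)) (Field l)| \<le>o l ^c ?s"
        proof
          fix a assume a: "a \<in> {a \<in> Field l. f a \<in> under k b}"
          then have "under k (f a) \<subseteq> under k b"
            using tr by (auto simp: under_def dest: transD)
          moreover have "f a \<in> Field k" using a f by blast
          ultimately have "l ^c |under k (f a)| \<le>o l ^c ?s"
            using Cnotzero_card_of_under[of k "f a"] k l
            by (intro cexp_mono2_Cnotzero card_of_mono1) auto
          then show "|Func (under k (f a)) (Field l)| \<le>o l ^c ?s"
            by (simp add: cexp_def Field_card_of)
        qed
      qed
      then have "|Q b| ^c |T| \<le>o (l ^c ?s) ^c |T|"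
        by (rule cexp_mono1[OF _ card_of_Card_order])
      \<comment> \<open>The iterated power is a single power, whose exponent stays below
        \<open>k\<close> because a regular cardinal is stable.\<close>
      also have "(l ^c ?s) ^c |T| =o l ^c (?s *c |T| )"
        using cexp_cprod l by blast
      also have "l ^c (?s *c |T| ) \<le>o cexp_less l k"
      proof (rule cexp_ordLeq_cexp_less)
        show "?s *c |T| <o k"
          unfolding cprod_def Field_card_of
          using stable_elim[of k "under k b" "\<lambda>_. T"] regularCard_stable[of k] k reg
            card_under_ordLess[OF k b] T
          by (simp add: cinfinite_def)
      qed (use l Card_order_cprod in auto)
      finally show "|Func T (Q b)| \<le>o cexp_less l k" by (simp add: cexp_def Field_card_of)
    qed
  qed
  finally show ?thesis .
qed

text \<open>Powers depend only on the size of the base, so \<open>m\<close> may be replaced by the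
  set of coded sequences, whose small powers are already bounded by
  \<open>cexp_less l k\<close>.\<close>

lemma cexp_less_idem:
  assumes k: "Cinfinite k" and reg: "regularCard k" and l: "Cinfinite l" and kl: "k \<le>o l"
    and m: "Card_order m" "m =o cexp_less l k"
  shows "cexp_less m k =o m"
proof -
  have fl: "|Field k| \<le>o |Field l|" using kl by (rule card_of_mono2)
  have ne: "Field k \<noteq> {}" using k unfolding cinfinite_def by auto
  obtain f where f: "f ` Field l = Field k"
    using iffD2[OF card_of_ordLeq2[OF ne] fl] by blast
  have iso: "m =o |coded_seqs k (Field l) f|"
    using card_coded_seqs[OF k l f] m(2) ordIso_transitive ordIso_symmetric by blast
  have "cexp_less m k \<le>o m"
  proof (rule cexp_less_least[OF m(1)])
    fix t :: "'a rel" assume t: "Card_order t" "t <o k"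
    have "|Field t| <o k" using t card_of_Field_ordIso ordIso_ordLess_trans by blast
    have "m ^c t =o |coded_seqs k (Field l) f| ^c t"
      by (rule cexp_cong1[OF iso t(1)])
    also have "|coded_seqs k (Field l) f| ^c t = |Func (Field t) (coded_seqs k (Field l) f)|"
      by (simp add: cexp_def Field_card_of)
    also have "|Func (Field t) (coded_seqs k (Field l) f)| \<le>o cexp_less l k"
      by (rule Func_coded_seqs_ordLeq) fact+
    also have "cexp_less l k =o m" using m(2) by (rule ordIso_symmetric)
    finally show "m ^c t \<le>o m" .
  qed
  then show ?thesis using ordLeq_cexp_less[OF k m(1)] by (simp add: ordIso_iff_ordLeq)
qed

section \<open>Maps with small supports\<close>

text \<open>
  For regular \<open>k\<close> the bounded topology is also generated by fixing the values on arbitrary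
  sets of fewer than \<open>k\<close> coordinates. In this form it does not refer to the order of the index
  set, so sequences may be indexed by any set of size \<open>k\<close>.
\<close>

definition small_supp_map ::
  "'k rel \<Rightarrow> 'i set \<Rightarrow> 'a set \<Rightarrow> 'j set \<Rightarrow> 'b set \<Rightarrow> (('i \<Rightarrow> 'a) \<Rightarrow> 'j \<Rightarrow> 'b) \<Rightarrow> bool" where
  "small_supp_map k I A J B F \<longleftrightarrow> F ` Func I A \<subseteq> Func J B \<and>
     (\<forall>x\<in>Func I A. \<forall>j\<in>J. \<exists>D\<subseteq>I. |D| <o k \<and>
        (\<forall>y\<in>Func I A. (\<forall>i\<in>D. y i = x i) \<longrightarrow> F y j = F x j))"

definition small_supp_iso :: "'k rel \<Rightarrow> 'i set \<Rightarrow> 'a set \<Rightarrow> 'j set \<Rightarrow> 'b set \<Rightarrow> bool" where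
  "small_supp_iso k I A J B \<longleftrightarrow> (\<exists>F G. small_supp_map k I A J B F \<and> small_supp_map k J B I A G \<and>
     (\<forall>x\<in>Func I A. G (F x) = x) \<and> (\<forall>y\<in>Func J B. F (G y) = y))"

text \<open>By regularity, the union of fewer than \<open>k\<close> supports, each smaller than
  \<open>k\<close>, is again smaller than \<open>k\<close>. Both composition and continuity rest on
  this.\<close>

lemma small_supp_map_on_small:
  assumes k: "Cinfinite k" "regularCard k" and F: "small_supp_map k I A J B F"
    and x: "x \<in> Func I A" and E: "E \<subseteq> J" "|E| <o k"
  obtains D where "D \<subseteq> I" "|D| <o k"
    "\<And>y j. y \<in> Func I A \<Longrightarrow> \<forall>i\<in>D. y i = x i \<Longrightarrow> j \<in> E \<Longrightarrow> F y j = F x j"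
proof -
  have "\<forall>j\<in>E. \<exists>D. D \<subseteq> I \<and> |D| <o k \<and>
      (\<forall>y\<in>Func I A. (\<forall>i\<in>D. y i = x i) \<longrightarrow> F y j = F x j)"
    using F x E(1) unfolding small_supp_map_def by blast
  then obtain D where D: "\<And>j. j \<in> E \<Longrightarrow> D j \<subseteq> I \<and> |D j| <o k \<and>
      (\<forall>y\<in>Func I A. (\<forall>i\<in>D j. y i = x i) \<longrightarrow> F y j = F x j)"
    by metis
  show ?thesis
  proof (rule that[of "\<Union>j\<in>E. D j"])
    show "|\<Union>j\<in>E. D j| <o k"
      using regularCard_UNION_bound k E(2) D by blast
  qed (use D in blast)+
qed

text \<open>A support for the composite at \<open>x\<close> gathers supports of \<open>F\<close> at
  \<open>x\<close> for all coordinates in a support of \<open>G\<close> at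
  \<open>F x\<close>.\<close>

lemma small_supp_map_comp:
  assumes k: "Cinfinite k" "regularCard k"
    and F: "small_supp_map k I A J B F" and G: "small_supp_map k J B L C G"
  shows "small_supp_map k I A L C (G \<circ> F)"
  unfolding small_supp_map_def
proof (intro conjI ballI)
  have FI: "F x \<in> Func J B" if "x \<in> Func I A" for x
    using F that unfolding small_supp_map_def by blast
  then show "(G \<circ> F) ` Func I A \<subseteq> Func L C"
    using G unfolding small_supp_map_def by auto
  fix x j assume x: "x \<in> Func I A" and j: "j \<in> L"
  obtain E where E: "E \<subseteq> J" "|E| <o k"
    "\<forall>y\<in>Func J B. (\<forall>i\<in>E. y i = F x i) \<longrightarrow> G y j = G (F x) j"
    using G FI[OF x] j unfolding small_supp_map_def by blast
  obtain D where "D \<subseteq> I" "|D| <o k"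
    "\<And>y j. y \<in> Func I A \<Longrightarrow> \<forall>i\<in>D. y i = x i \<Longrightarrow> j \<in> E \<Longrightarrow> F y j = F x j"
    using small_supp_map_on_small[OF k F x E(1,2)] by blast
  then show "\<exists>D\<subseteq>I. |D| <o k \<and>
      (\<forall>y\<in>Func I A. (\<forall>i\<in>D. y i = x i) \<longrightarrow> (G \<circ> F) y j = (G \<circ> F) x j)"
    using E(3) FI by (intro exI[of _ D]) auto
qed

lemma small_supp_iso_trans:
  assumes k: "Cinfinite k" "regularCard k"
    and 1: "small_supp_iso k I A J B" and 2: "small_supp_iso k J B L C"
  shows "small_supp_iso k I A L C"
proof -
  obtain F G where FG: "small_supp_map k I A J B F" "small_supp_map k J B I A G"
    "\<forall>x\<in>Func I A. G (F x) = x" "\<forall>y\<in>Func J B. F (G y) = y"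
    using 1 unfolding small_supp_iso_def by blast
  obtain F' G' where FG': "small_supp_map k J B L C F'" "small_supp_map k L C J B G'"
    "\<forall>x\<in>Func J B. G' (F' x) = x" "\<forall>y\<in>Func L C. F' (G' y) = y"
    using 2 unfolding small_supp_iso_def by blast
  have "F ` Func I A \<subseteq> Func J B" "G' ` Func L C \<subseteq> Func J B"
    using FG(1) FG'(2) unfolding small_supp_map_def by blast+
  then show ?thesis
    unfolding small_supp_iso_def
    using FG FG' small_supp_map_comp[OF k FG(1) FG'(1)] small_supp_map_comp[OF k FG'(2) FG(2)]
    by (intro exI[of _ "F' \<circ> F"] exI[of _ "G \<circ> G'"]) auto
qed

lemma small_supp_map_reindex:
  assumes k: "Cinfinite k" and h: "h ` J \<subseteq> I" and g: "g ` A \<subseteq> B"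
  shows "small_supp_map k I A J B (\<lambda>x. \<lambda>j\<in>J. g (x (h j)))"
  unfolding small_supp_map_def
proof (intro conjI ballI)
  show "(\<lambda>x. \<lambda>j\<in>J. g (x (h j))) ` Func I A \<subseteq> Func J B"
    using h g by (auto simp: Func_def image_subset_iff)
  fix x j assume "x \<in> Func I A" and j: "j \<in> J"
  have "|{h j}| <o k"
    using k by (rule finite_imp_card_of_ordLess) simp
  then show "\<exists>D\<subseteq>I. |D| <o k \<and> (\<forall>y\<in>Func I A. (\<forall>i\<in>D. y i = x i) \<longrightarrow>
      (\<lambda>j\<in>J. g (y (h j))) j = (\<lambda>j\<in>J. g (x (h j))) j)"
    using j h by (intro exI[of _ "{h j}"]) auto
qed

text \<open>Each output coordinate reads a single input coordinate. This allows index sets and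
  alphabets to be replaced by equinumerous ones.\<close>

lemma small_supp_iso_reindex:
  assumes k: "Cinfinite k" and h: "bij_betw h J I" and g: "bij_betw g A B"
  shows "small_supp_iso k I A J B"
  unfolding small_supp_iso_def
proof (intro exI conjI ballI)
  let ?h = "inv_into J h" and ?g = "inv_into A g"
  have h': "bij_betw ?h I J" and g': "bij_betw ?g B A"
    using h g by (auto intro: bij_betw_inv_into)
  show "small_supp_map k I A J B (\<lambda>x. \<lambda>j\<in>J. g (x (h j)))"
    using h g by (intro small_supp_map_reindex[OF k]) (auto simp: bij_betw_def)
  show "small_supp_map k J B I A (\<lambda>x. \<lambda>i\<in>I. ?g (x (?h i)))"
    using h' g' by (intro small_supp_map_reindex[OF k]) (auto simp: bij_betw_def)
  show "(\<lambda>i\<in>I. ?g ((\<lambda>j\<in>J. g (x (h j))) (?h i))) = x" if "x \<in> Func I A" for x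
    using that bij_betwE[OF h'] bij_betw_inv_into_left[OF g] bij_betw_inv_into_right[OF h]
    by (auto simp: fun_eq_iff Func_def)
  show "(\<lambda>j\<in>J. g ((\<lambda>i\<in>I. ?g (y (?h i))) (h j))) = y" if "y \<in> Func J B" for y
    using that bij_betwE[OF h] bij_betw_inv_into_right[OF g] bij_betw_inv_into_left[OF h]
    by (auto simp: fun_eq_iff Func_def)
qed

section \<open>From small supports to the bounded topology\<close>

lemma openin_bounded_topologyI:
  assumes k: "Cinfinite k" "regularCard k" and V: "V \<subseteq> Func (Field k) A"
    and nbhd: "\<And>x. x \<in> V \<Longrightarrow> \<exists>D\<subseteq>Field k. |D| <o k \<and>
      (\<forall>y\<in>Func (Field k) A. (\<forall>i\<in>D. y i = x i) \<longrightarrow> y \<in> V)"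
  shows "openin (bounded_topology k A) V"
proof (subst openin_subopen, intro ballI)
  fix x assume x: "x \<in> V"
  obtain D where D: "D \<subseteq> Field k" "|D| <o k"
    "\<forall>y\<in>Func (Field k) A. (\<forall>i\<in>D. y i = x i) \<longrightarrow> y \<in> V"
    using nbhd[OF x] by blast
  \<comment> \<open>By regularity, fewer than \<open>k\<close> coordinates cannot be cofinal. Some
    \<open>a\<close> is thus strictly below no element of \<open>D\<close>, and by totality every
    element of \<open>D\<close> is at most \<open>a\<close>.\<close>
  have "\<not> cofinal D k"
    using D(1,2) k(2) not_ordLess_ordIso unfolding regularCard_def by blast
  then obtain a where a: "a \<in> Field k" "\<And>b. b \<in> D \<Longrightarrow> a \<noteq> b \<Longrightarrow> (a, b) \<notin> k"
    unfolding cofinal_def by blast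
  have tot: "Total k" and ref: "Refl k" and wo: "Well_order k"
    using k(1) card_order_on_well_order_on well_order_on_def linear_order_on_def
      partial_order_on_def preorder_on_def by metis+
  \<comment> \<open>The bound \<open>a\<close> may itself lie in \<open>D\<close>. An infinite
    cardinal is a limit, so there is a larger \<open>c\<close>, and \<open>underS k c\<close>
    contains all of \<open>D\<close>.\<close>
  obtain c where c: "c \<in> Field k" "a \<noteq> c" "(a, c) \<in> k"
    using infinite_Card_order_limit[of k a] k(1) a(1) unfolding cinfinite_def by blast
  have Dc: "D \<subseteq> underS k c"
  proof
    fix b assume b: "b \<in> D"
    have "(b, a) \<in> k"
      using a(1) a(2)[OF b] subsetD[OF D(1) b] tot refl_onD[OF ref]
      unfolding total_on_def by metis
    then show "b \<in> underS k c"
      using c a(2)[OF b] wo unfolding underS_def well_order_on_def linear_order_on_def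
        partial_order_on_def preorder_on_def
      by (auto dest: transD antisymD)
  qed
  let ?s = "\<lambda>b\<in>underS k c. x b"
  have "?s \<in> Func (underS k c) A"
    using x V underS_Field[of _ k c] by (auto simp: Func_def)
  then have "openin (bounded_topology k A) (seq_cone k A c ?s)"
    unfolding bounded_topology_def using c(1) by (intro topology_generated_by_Basis) blast
  moreover have "x \<in> seq_cone k A c ?s" using x V by (auto simp: seq_cone_def)
  moreover have "seq_cone k A c ?s \<subseteq> V" using D(3) Dc by (auto simp: seq_cone_def)
  ultimately show "\<exists>T. openin (bounded_topology k A) T \<and> x \<in> T \<and> T \<subseteq> V" by blast
qed

text \<open>It suffices to consider preimages of the generating cones. Membership in a cone depends
  on the coordinates in \<open>underS k a\<close>, which are fewer than \<open>k\<close>, so a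
  common small support exists.\<close>

lemma continuous_map_small_supp:
  assumes k: "Cinfinite k" "regularCard k"
    and F: "small_supp_map k (Field k) A (Field k) B F"
  shows "continuous_map (bounded_topology k A) (bounded_topology k B) F"
proof -
  have ne: "Field k \<noteq> {}" using k(1) unfolding cinfinite_def by auto
  have FI: "F x \<in> Func (Field k) B" if "x \<in> Func (Field k) A" for x
    using F that unfolding small_supp_map_def by blast
  have "openin (bounded_topology k A) (F -` seq_cone k B a s \<inter> Func (Field k) A)"
    if a: "a \<in> Field k" for a s
  proof (rule openin_bounded_topologyI[OF k])
    fix x assume x: "x \<in> F -` seq_cone k B a s \<inter> Func (Field k) A"
    obtain D where "D \<subseteq> Field k" "|D| <o k"
      "\<And>y j. y \<in> Func (Field k) A \<Longrightarrow> \<forall>i\<in>D. y i = x i \<Longrightarrow> j \<in> underS k a \<Longrightarrow> F y j = F x j"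
      using small_supp_map_on_small[OF k F _ _ card_of_underS, of x a] x a k(1)
        underS_Field[of _ k a] by blast
    then show "\<exists>D\<subseteq>Field k. |D| <o k \<and> (\<forall>y\<in>Func (Field k) A. (\<forall>i\<in>D. y i = x i) \<longrightarrow>
        y \<in> F -` seq_cone k B a s \<inter> Func (Field k) A)"
      using x FI by (intro exI[of _ D]) (auto simp: seq_cone_def)
  qed auto
  moreover have "F ` topspace (bounded_topology k A) \<subseteq> topspace (bounded_topology k B)"
    using FI by (auto simp: topspace_bounded_topology[OF ne])
  ultimately show ?thesis
    unfolding bounded_topology_def[of k B] continuous_on_generated_topo_iff
      topology_generated_by_topspace topspace_bounded_topology[OF ne]
    by blast
qed

lemma homeomorphic_space_small_supp:
  assumes k: "Cinfinite k" "regularCard k" and iso: "small_supp_iso k (Field k) A (Field k) B"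
  shows "bounded_topology k A homeomorphic_space bounded_topology k B"
proof -
  have ne: "Field k \<noteq> {}" using k(1) unfolding cinfinite_def by auto
  from iso obtain F G where FG: "small_supp_map k (Field k) A (Field k) B F"
    "small_supp_map k (Field k) B (Field k) A G"
    "\<forall>x\<in>Func (Field k) A. G (F x) = x" "\<forall>y\<in>Func (Field k) B. F (G y) = y"
    unfolding small_supp_iso_def by blast
  then show ?thesis
    unfolding homeomorphic_space_def homeomorphic_maps_def topspace_bounded_topology[OF ne]
    using FG continuous_map_small_supp[OF k FG(1)] continuous_map_small_supp[OF k FG(2)]
    by (intro exI[of _ F] exI[of _ G]) simp
qed

section \<open>Absorbing the coded sequences\<close>

text \<open>
  A row of \<open>x\<close> consists of a header \<open>a = x (Inl i)\<close> and a sequence \<open>x (Inr (i, _))\<close>. The header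
  determines the set \<open>U a\<close> on which the row is read as one letter of the new alphabet. What is left
  of all the rows, with the complements of the \<open>U a\<close> renumbered by \<open>g a\<close>, is spread over the
  second components by \<open>b\<close>.
\<close>

lemma small_supp_iso_absorb:
  fixes A :: "'a set" and I :: "'i set"
  assumes k: "Cinfinite k"
    and U: "\<And>a. a \<in> A \<Longrightarrow> U a \<subseteq> I" "\<And>a. a \<in> A \<Longrightarrow> |U a| <o k"
    and g: "\<And>a. a \<in> A \<Longrightarrow> bij_betw (g a) I (I - U a)"
    and b: "bij_betw b I (I \<times> I)"
  shows "small_supp_iso k (I <+> I \<times> I) A I ((SIGMA a:A. Func (U a) A) \<times> A)"
proof -
  let ?J = "I <+> I \<times> I" and ?B = "(SIGMA a:A. Func (U a) A) \<times> A"
  \<comment> \<open>Coordinate \<open>i\<close> receives two unrelated pieces: the letter read from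
    row \<open>i\<close>, and one leftover entry, taken from row \<open>fst (b i)\<close> at
    renumbered place \<open>snd (b i)\<close>.\<close>
  define F where "F x = (\<lambda>i\<in>I. ((x (Inl i), \<lambda>j\<in>U (x (Inl i)). x (Inr (i, j))),
      x (Inr (fst (b i), g (x (Inl (fst (b i)))) (snd (b i))))))" for x :: "'i + 'i \<times> 'i \<Rightarrow> 'a"
  \<comment> \<open>Entry \<open>j\<close> of row \<open>i\<close> is recovered from the letter if
    \<open>j\<close> was read. Otherwise it is looked up among the leftovers, at the index found by
    undoing \<open>g a\<close> and \<open>b\<close>.\<close>
  define H where "H w i j = (let (a, p) = fst (w i) in
      if j \<in> U a then p j else snd (w (inv_into I b (i, inv_into I (g a) j))))"
    for w :: "'i \<Rightarrow> ('a \<times> ('i \<Rightarrow> 'a)) \<times> 'a" and i j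
  define G where "G w = (\<lambda>c\<in>?J. case c of Inl i \<Rightarrow> fst (fst (w i)) | Inr (i, j) \<Rightarrow> H w i j)"
    for w
  note fin = finite_imp_card_of_ordLess[OF k]
  have b1: "fst (b i) \<in> I" "snd (b i) \<in> I" if "i \<in> I" for i
    using bij_betwE[OF b] that by (auto simp: mem_Times_iff)
  have b2: "inv_into I b (m, n) \<in> I" "b (inv_into I b (m, n)) = (m, n)" if "m \<in> I" "n \<in> I" for m n
    using bij_betwE[OF bij_betw_inv_into[OF b]] bij_betw_inv_into_right[OF b] that by auto
  have b3: "inv_into I b (b i) = i" if "i \<in> I" for i
    using bij_betw_inv_into_left[OF b that] .
  have g1: "g a n \<in> I" "g a n \<notin> U a" if "a \<in> A" "n \<in> I" for a n
    using bij_betwE[OF g[OF that(1)]] that(2) by auto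
  have g2: "inv_into I (g a) j \<in> I" "g a (inv_into I (g a) j) = j"
    if "a \<in> A" "j \<in> I" "j \<notin> U a" for a j
    using bij_betwE[OF bij_betw_inv_into[OF g[OF that(1)]]]
      bij_betw_inv_into_right[OF g[OF that(1)]] that by auto
  have g3: "inv_into I (g a) (g a n) = n" if "a \<in> A" "n \<in> I" for a n
    using bij_betw_inv_into_left[OF g[OF that(1)] that(2)] .
  have FB: "F x \<in> Func I ?B" if x: "x \<in> Func ?J A" for x
  proof -
    have x': "x (Inl i) \<in> A" "j \<in> I \<Longrightarrow> x (Inr (i, j)) \<in> A" if "i \<in> I" for i j
      using x that by (auto simp: Func_def)
    then show ?thesis
      using b1 g1 U(1) by (fastforce simp: Func_def F_def)
  qed
  have GA: "G w \<in> Func ?J A" if w: "w \<in> Func I ?B" for w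
  proof -
    have w': "\<exists>a p c. w i = ((a, p), c) \<and> a \<in> A \<and> p \<in> Func (U a) A \<and> c \<in> A" if "i \<in> I" for i
      using w that by (fastforce simp: Func_def)
    have "fst (fst (w i)) \<in> A" if "i \<in> I" for i
      using w'[OF that] by auto
    moreover have "H w i j \<in> A" if i: "i \<in> I" and j: "j \<in> I" for i j
    proof -
      obtain a p c where wi: "w i = ((a, p), c)" "a \<in> A" "p \<in> Func (U a) A"
        using w'[OF i] by blast
      show ?thesis
      proof (cases "j \<in> U a")
        case True
        then show ?thesis using wi by (auto simp: H_def Func_def)
      next
        case False
        have "inv_into I b (i, inv_into I (g a) j) \<in> I"
          using b2 g2 i j wi False by blast
        from w'[OF this] show ?thesis using wi False by (auto simp: H_def)
      qed
    qed
    ultimately show ?thesis by (auto simp: Func_def G_def)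
  qed
  have "small_supp_map k ?J A I ?B F"
    unfolding small_supp_map_def
  proof (intro conjI ballI)
    fix x i assume x: "x \<in> Func ?J A" and i: "i \<in> I"
    let ?m = "fst (b i)"
    \<comment> \<open>The header \<open>Inl ?m\<close> is included because it decides which entry of
      row \<open>?m\<close> is the leftover. Fixing \<open>Inl i\<close> likewise fixes the set of
      places read in \<open>?D2\<close>.\<close>
    let ?D1 = "{Inl i, Inl ?m, Inr (?m, g (x (Inl ?m)) (snd (b i)))}"
    let ?D2 = "(\<lambda>j. Inr (i, j)) ` U (x (Inl i))"
    have xA: "x (Inl i) \<in> A" "x (Inl ?m) \<in> A"
      using x i b1 by (auto simp: Func_def)
    have "|?D2| <o k"
      using U(2)[OF xA(1)] card_of_image ordLeq_ordLess_trans by blast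
    then have "|?D1 \<union> ?D2| <o k"
      using k fin[of ?D1] card_of_Un_ordLess_infinite_Field[of k ?D1 ?D2]
      unfolding cinfinite_def by blast
    moreover have "?D1 \<union> ?D2 \<subseteq> ?J"
      using i b1 xA g1 U(1) by blast
    moreover have "F y i = F x i" if "\<forall>c\<in>?D1 \<union> ?D2. y c = x c" for y
      using that i by (auto simp: F_def fun_eq_iff restrict_def)
    ultimately show "\<exists>D\<subseteq>?J. |D| <o k \<and> (\<forall>y\<in>Func ?J A. (\<forall>i\<in>D. y i = x i) \<longrightarrow> F y i = F x i)"
      by (intro exI[of _ "?D1 \<union> ?D2"]) blast
  qed (use FB in auto)
  moreover have "small_supp_map k I ?B ?J A G"
    unfolding small_supp_map_def
  proof (intro conjI ballI)
    fix w c assume w: "w \<in> Func I ?B" and c: "c \<in> ?J"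
    show "\<exists>D\<subseteq>I. |D| <o k \<and> (\<forall>y\<in>Func I ?B. (\<forall>i\<in>D. y i = w i) \<longrightarrow> G y c = G w c)"
    proof (cases c)
      case (Inl i)
      then show ?thesis
        using c fin[of "{i}"] by (intro exI[of _ "{i}"]) (auto simp: G_def)
    next
      case (Inr q)
      obtain i j where ij: "c = Inr (i, j)" "i \<in> I" "j \<in> I"
        using Inr c by (cases q) auto
      \<comment> \<open>This is where the leftover entry for \<open>(i, j)\<close> is stored. It
        depends on the header in \<open>w i\<close>, so \<open>i\<close> must belong to the support
        along with \<open>?n\<close>.\<close>
      let ?n = "inv_into I b (i, inv_into I (g (fst (fst (w i)))) j)"
      show ?thesis
      proof (cases "j \<in> U (fst (fst (w i)))")
        case True
        then show ?thesis
          using ij fin[of "{i}"]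
          by (intro exI[of _ "{i}"]) (auto simp: G_def H_def split: prod.splits)
      next
        case False
        have "fst (fst (w i)) \<in> A"
          using w ij by (auto simp: Func_def mem_Times_iff)
        then have "?n \<in> I" using False ij b2 g2 by blast
        then show ?thesis
          using ij fin[of "{i, ?n}"]
          by (intro exI[of _ "{i, ?n}"]) (auto simp: G_def H_def split: prod.splits)
      qed
    qed
  qed (use GA in auto)
  moreover have "G (F x) = x" if x: "x \<in> Func ?J A" for x
  proof
    fix c
    have xA: "x (Inl i) \<in> A" if "i \<in> I" for i
      using x that by (auto simp: Func_def)
    show "G (F x) c = x c"
    proof (cases "c \<in> ?J")
      case False
      then show ?thesis using x by (auto simp: G_def Func_def)
    next
      case True
      then consider i where "c = Inl i" "i \<in> I" | i j where "c = Inr (i, j)" "i \<in> I" "j \<in> I"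
        by auto
      then show ?thesis
      proof cases
        case 1
        then show ?thesis by (auto simp: G_def F_def)
      next
        case (2 i j)
        then show ?thesis
          using xA[of i] b2 g2 by (auto simp: G_def H_def F_def)
      qed
    qed
  qed
  moreover have "F (G w) = w" if w: "w \<in> Func I ?B" for w
  proof
    fix i
    show "F (G w) i = w i"
    proof (cases "i \<in> I")
      case False
      then show ?thesis using w by (auto simp: F_def Func_def)
    next
      case i: True
      have w': "\<exists>a p c. w i = ((a, p), c) \<and> a \<in> A \<and> p \<in> Func (U a) A" if "i \<in> I" for i
        using w that by (fastforce simp: Func_def)
      obtain a p c where wi: "w i = ((a, p), c)" "a \<in> A" "p \<in> Func (U a) A"
        using w'[OF i] by blast
      have G1: "G w (Inl m) = fst (fst (w m))" if "m \<in> I" for m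
        using that by (auto simp: G_def)
      have G2: "G w (Inr (m, j)) = H w m j" if "m \<in> I" "j \<in> I" for m j
        using that by (auto simp: G_def)
      have "(\<lambda>j\<in>U a. G w (Inr (i, j))) = p"
        using wi i U(1)[OF wi(2)] by (auto simp: fun_eq_iff Func_def G2 H_def subset_iff)
      \<comment> \<open>The place produced by \<open>g\<close> lies outside the set read in that
        row, so \<open>H\<close> takes its second branch, and there \<open>g3\<close> and
        \<open>b3\<close> lead back to index \<open>i\<close>.\<close>
      moreover have "G w (Inr (fst (b i), g (G w (Inl (fst (b i)))) (snd (b i)))) = c"
      proof -
        obtain a' p' c' where wm: "w (fst (b i)) = ((a', p'), c')" "a' \<in> A"
          using w'[OF b1(1)[OF i]] by blast
        show ?thesis
          using wm b1[OF i] g1 g3 b3[OF i] wi by (simp add: G1 G2 H_def)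
      qed
      ultimately show ?thesis
        using i wi by (simp add: F_def G1)
    qed
  qed
  ultimately show ?thesis unfolding small_supp_iso_def by blast
qed

section \<open>Index sets of size \<open>k\<close>\<close>

lemma card_of_Diff_small:
  assumes k: "Cinfinite k" and U: "|U| <o k"
  shows "|Field k - U| =o k"
proof -
  \<comment> \<open>Otherwise two sets smaller than the infinite \<open>k\<close> would cover
    \<open>Field k\<close>.\<close>
  have "\<not> |Field k - U| <o k"
  proof
    assume "|Field k - U| <o k"
    with U have "|U \<union> (Field k - U)| <o k"
      using k card_of_Un_ordLess_infinite_Field unfolding cinfinite_def by blast
    moreover have "k \<le>o |U \<union> (Field k - U)|"
      using k card_of_Field_ordIso[of k] card_of_mono1[of "Field k" "U \<union> (Field k - U)"]
        ordIso_ordLeq_trans ordIso_symmetric by blast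
    ultimately show False using not_ordLess_ordLeq by blast
  qed
  then have "k \<le>o |Field k - U|"
    using k card_of_Well_order card_order_on_well_order_on not_ordLess_iff_ordLeq by blast
  moreover have "|Field k - U| \<le>o k"
    using k card_of_mono1[of "Field k - U" "Field k"] card_of_Field_ordIso ordLeq_ordIso_trans
    by blast
  ultimately show ?thesis by (simp add: ordIso_iff_ordLeq)
qed

lemma card_of_Field_Plus_Times:
  assumes k: "Cinfinite k"
  shows "|Field k <+> Field k \<times> Field k| =o |Field k|"
proof -
  have "|Field k \<times> Field k| =o |Field k|"
    using k card_of_Times_same_infinite unfolding cinfinite_def by blast
  then show ?thesis
    using k card_of_Plus_infinite1[of "Field k" "Field k \<times> Field k"] ordIso_imp_ordLeq
    unfolding cinfinite_def by blast
qed

text \<open>Every coded segment is smaller than \<open>k\<close>, so its complement still has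
  \<open>k\<close> places and can be renumbered by \<open>Field k\<close>. Headers and rows together
  are indexed by a set of size \<open>k\<close>, which \<open>h\<close> identifies with
  \<open>Field k\<close>.\<close>

lemma small_supp_iso_coded_seqs:
  assumes k: "Cinfinite k" "regularCard k" and f: "f ` A \<subseteq> Field k"
  shows "small_supp_iso k (Field k) A (Field k) (coded_seqs k A f \<times> A)"
proof -
  let ?I = "Field k"
  obtain h where h: "bij_betw h (?I <+> ?I \<times> ?I) ?I"
    using card_of_Field_Plus_Times[OF k(1)] card_of_ordIso by blast
  have "|?I| =o |?I \<times> ?I|"
    using k card_of_Times_same_infinite ordIso_symmetric unfolding cinfinite_def by blast
  then obtain b where b: "bij_betw b ?I (?I \<times> ?I)"
    using card_of_ordIso by blast
  have small: "|under k (f a)| <o k" if "a \<in> A" for a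
    using card_under_ordLess[OF k(1)] f that by blast
  have "\<exists>g. bij_betw g ?I (?I - under k (f a))" if "a \<in> A" for a
  proof -
    have "|?I| =o |?I - under k (f a)|"
      using card_of_Diff_small[OF k(1) small[OF that]] k card_of_Field_ordIso
        ordIso_symmetric ordIso_transitive by blast
    then show ?thesis using card_of_ordIso by blast
  qed
  then obtain g where g: "\<And>a. a \<in> A \<Longrightarrow> bij_betw (g a) ?I (?I - under k (f a))"
    by metis
  have "small_supp_iso k (?I <+> ?I \<times> ?I) A ?I (coded_seqs k A f \<times> A)"
    unfolding coded_seqs_def
    by (rule small_supp_iso_absorb[OF k(1) under_Field small g b])
  then show ?thesis
    using small_supp_iso_trans[OF k small_supp_iso_reindex[OF k(1) h bij_betw_id]] by blast
qed

section \<open>Choice of the length code and renaming of the alphabet\<close>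

theorem proposition2p6:
  fixes k :: "'k rel" and l :: "'l rel" and l' :: "'m rel"
  assumes "Cinfinite k" and "Cinfinite l" and "k \<le>o l" and "regularCard k"
    and "Card_order l'" and "l' =o cexp_less l k"
  shows "cexp_less l' k =o l' \<and>
         bounded_topology k (Field l) homeomorphic_space bounded_topology k (Field l')"
proof
  note k = assms(1,4) and l = assms(2) and m = assms(5,6)
  show "cexp_less l' k =o l'"
    by (rule cexp_less_idem) fact+
  have ne: "Field k \<noteq> {}" using k unfolding cinfinite_def by auto
  \<comment> \<open>As \<open>k \<le>o l\<close>, the elements of \<open>Field l\<close> suffice to
    code all lengths; hitting every length gives \<open>?C\<close> its full size.\<close>
  obtain f where f: "f ` Field l = Field k"
    using iffD2[OF card_of_ordLeq2[OF ne] card_of_mono2[OF assms(3)]] by blast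
  let ?C = "coded_seqs k (Field l) f"
  have C: "|?C| =o cexp_less l k" by (rule card_coded_seqs[OF k(1) l f])
  then have infC: "Cinfinite |?C|"
    using Cinfinite_cong ordIso_symmetric Cinfinite_cexp_less[OF k(1) l] by blast
  have "|Field l| \<le>o |?C|"
    using ordLeq_cexp_less[OF k(1), of l] card_of_Field_ordIso[of l] l C
      ordIso_ordLeq_trans ordLeq_ordIso_trans ordIso_symmetric by blast
  moreover have "Field l \<noteq> {}" using l unfolding cinfinite_def by auto
  \<comment> \<open>The factor carrying the remainders of the rows is absorbed by the infinite
    \<open>?C\<close>, which is at least as large. The new alphabet can therefore be renamed to
    \<open>Field l'\<close>.\<close>
  ultimately have "|?C \<times> Field l| =o |?C|"
    using card_of_Times_infinite[of ?C "Field l"] infC by (auto simp: cinfinite_def Field_card_of)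
  also have "|?C| =o l'" using C m(2) ordIso_symmetric ordIso_transitive by blast
  also have "l' =o |Field l'|" using card_of_Field_ordIso[OF m(1)] by (rule ordIso_symmetric)
  finally obtain g where "bij_betw g (?C \<times> Field l) (Field l')"
    using card_of_ordIso by blast
  then have "small_supp_iso k (Field k) (?C \<times> Field l) (Field k) (Field l')"
    by (rule small_supp_iso_reindex[OF k(1) bij_betw_id])
  moreover have "small_supp_iso k (Field k) (Field l) (Field k) (?C \<times> Field l)"
    by (rule small_supp_iso_coded_seqs[OF k]) (simp add: f)
  ultimately show "bounded_topology k (Field l) homeomorphic_space bounded_topology k (Field l')"
    using homeomorphic_space_small_supp[OF k] small_supp_iso_trans[OF k] by blast
qed

end
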